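(* Let $\mathrm{k}$ be a field of characteristic zero. Let $A$ and $B$ be the infinite lower triangular matrices (indexed by $i,j\ge1$) with entries in $\mathrm{k}[x]$ given for $i\ge j$ by $$A_{ij}=\frac{j}{i}\,p_{i-j}^{j,j}(x),\qquad B_{ij}=p_{i-j}^{-i,-i}(x).$$ Then $AB$ is the identity matrix.
   Context: Lower triangular means all entries with $i<j$ are zero. For integers $n\ge0$ and rational $\alpha,\beta$, the Jacobi polynomial is $$P^{\alpha,\beta}_n(x)=\frac1{n!}\sum_{k=0}^n\binom{n}{k}(n+\alpha+\beta+1)\cdots(n+\alpha+\beta+k)\,(\alpha+k+1)\cdots(\alpha+n)\left(\frac{x-1}{2}\right)^k$$ (empty products equal $1$), and $p_n^{\alpha,\beta}(x)=(x-1)^nP_n^{\alpha,\beta}\left(\frac{x+1}{x-1}\right)$, which is a polynomial in $x$. *)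

theory Defs
  imports "HOL-Computational_Algebra.Computational_Algebra"
begin

definition jacobi_poly :: "nat \<Rightarrow> rat \<Rightarrow> rat \<Rightarrow> rat poly" where
  "jacobi_poly n \<alpha> \<beta> = smult (1 / fact n)
     (\<Sum>k\<le>n. smult (of_nat (n choose k)
        * (\<Prod>i=1..k. of_nat n + \<alpha> + \<beta> + of_nat i)
        * (\<Prod>i=k+1..n. \<alpha> + of_nat i)) ([:- (1 / 2), 1 / 2:] ^ k))"

(* Value of P at the rational function (x + 1) / (x - 1), multiplied by (x - 1) ^ n, in Q(x). *)
definition cayley_transform :: "nat \<Rightarrow> rat poly \<Rightarrow> rat poly fract" where
  "cayley_transform n P = to_fract [:- 1, 1:] ^ n
     * poly (map_poly (\<lambda>c. to_fract [:c:]) P) (Fract [:1, 1:] [:- 1, 1:])"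

lemma cayley_transform_ex1:
  assumes "degree P \<le> n"
  shows "\<exists>!q. to_fract q = cayley_transform n P"
proof -
  define D N :: "rat poly fract" where "D = to_fract [:- 1, 1:]" and "N = to_fract [:1, 1:]"
  define Q where "Q = map_poly (\<lambda>c. to_fract [:c:]) P"
  have D0: "D \<noteq> 0" by (simp add: D_def)
  have cQ: "coeff Q i = to_fract [:coeff P i:]" for i
    by (simp add: Q_def coeff_map_poly)
  have dQ: "degree Q \<le> n"
    using assms by (intro degree_le) (simp add: cQ coeff_eq_0)
  have to_fract_power: "to_fract (a ^ m) = to_fract a ^ m" for a :: "rat poly" and m
    by (induction m) simp_all
  have to_fract_sum: "to_fract (sum f S) = (\<Sum>i\<in>S. to_fract (f i))"
    if "finite S" for f :: "nat \<Rightarrow> rat poly" and S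
    using that by (induction S) simp_all
  have "poly Q (N / D) = (\<Sum>i\<le>n. coeff Q i * (N / D) ^ i)"
    using dQ by (subst poly_altdef, intro sum.mono_neutral_left) (auto simp: coeff_eq_0)
  then have "D ^ n * poly Q (N / D) = (\<Sum>i\<le>n. D ^ n * (coeff Q i * (N / D) ^ i))"
    by (simp add: sum_distrib_left)
  also have "\<dots> = (\<Sum>i\<le>n. coeff Q i * N ^ i * D ^ (n - i))"
  proof (rule sum.cong)
    fix i assume "i \<in> {..n}"
    then have "D ^ n = D ^ i * D ^ (n - i)" by (simp flip: power_add)
    then show "D ^ n * (coeff Q i * (N / D) ^ i) = coeff Q i * N ^ i * D ^ (n - i)"
      using D0 by (simp add: power_divide)
  qed simp
  also have "\<dots> = to_fract (\<Sum>i\<le>n. [:coeff P i:] * [:1, 1:] ^ i * [:- 1, 1:] ^ (n - i))"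
    by (simp only: to_fract_sum[OF finite_atMost] to_fract_mult to_fract_power cQ D_def N_def)
  finally have "\<exists>q. to_fract q = cayley_transform n P"
    unfolding cayley_transform_def D_def N_def Q_def Fract_conv_to_fract
    by (intro exI) (rule sym)
  then show ?thesis
    by (metis to_fract_eq_iff)
qed

lemma degree_jacobi_poly: "degree (jacobi_poly n \<alpha> \<beta>) \<le> n"
  unfolding jacobi_poly_def
proof (intro order.trans[OF degree_smult_le] degree_sum_le)
  fix k assume "k \<in> {..n}"
  have "degree ([:- (1 / 2), 1 / 2:] ^ k :: rat poly) \<le> k"
    using degree_power_le[of "[:- (1 / 2), 1 / 2:] :: rat poly" k] by simp
  with \<open>k \<in> {..n}\<close> show "degree ([:- (1 / 2), 1 / 2:] ^ k :: rat poly) \<le> n" by simp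
qed simp

definition jacobi_p :: "nat \<Rightarrow> rat \<Rightarrow> rat \<Rightarrow> rat poly" where
  "jacobi_p n \<alpha> \<beta> = (THE q. to_fract q = cayley_transform n (jacobi_poly n \<alpha> \<beta>))"

lemma to_fract_jacobi_p:
  "to_fract (jacobi_p n \<alpha> \<beta>) = cayley_transform n (jacobi_poly n \<alpha> \<beta>)"
  unfolding jacobi_p_def by (rule theI'[OF cayley_transform_ex1[OF degree_jacobi_poly]])

(* Infinite matrices are functions of two natural numbers; only indices >= 1 are meaningful. *)

definition lower_triangular :: "(nat \<Rightarrow> nat \<Rightarrow> 'a :: zero) \<Rightarrow> bool" where
  "lower_triangular M \<longleftrightarrow> (\<forall>i\<ge>1. \<forall>j\<ge>1. i < j \<longrightarrow> M i j = 0)"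

(* The sum over all k >= 1, restricted to its nonzero terms. *)
definition inf_mat_mult ::
  "(nat \<Rightarrow> nat \<Rightarrow> 'a :: semiring_0) \<Rightarrow> (nat \<Rightarrow> nat \<Rightarrow> 'a) \<Rightarrow> nat \<Rightarrow> nat \<Rightarrow> 'a" where
  "inf_mat_mult M N i j = (\<Sum>k | k \<ge> 1 \<and> M i k * N k j \<noteq> 0. M i k * N k j)"

lemma inf_mat_mult_lower_triangular:
  assumes "lower_triangular M" "lower_triangular N" "i \<ge> 1" "j \<ge> 1"
  shows "finite {k. k \<ge> 1 \<and> M i k * N k j \<noteq> 0}"
    and "inf_mat_mult M N i j = (\<Sum>k=j..i. M i k * N k j)"
proof -
  have sub: "{k. k \<ge> 1 \<and> M i k * N k j \<noteq> 0} \<subseteq> {j..i}"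
    using assms by (force simp: lower_triangular_def not_le[symmetric])
  then show "finite {k. k \<ge> 1 \<and> M i k * N k j \<noteq> 0}"
    by (rule finite_subset) simp
  show "inf_mat_mult M N i j = (\<Sum>k=j..i. M i k * N k j)"
    unfolding inf_mat_mult_def using sub assms(4)
    by (intro sum.mono_neutral_left) auto
qed

end

theory Submission
  imports Defs
begin

text \<open>
  Vandermonde convolution turns the definition into
  \<open>p_n(\<alpha>, \<beta>) = [z^n] (1 + x z)^(n + \<alpha>) (1 + z)^(n + \<beta>)\<close>. With \<open>\<phi> = (1 + x z) (1 + z)\<close>
  the entries are therefore \<open>A i j = (j / i) [z^(i - j)] \<phi>^i\<close> and
  \<open>B i j = [z^(i - j)] \<phi>^(-j)\<close>. The \<open>j\<close>-th column of \<open>B\<close> has generating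
  function \<open>(z / \<phi>)^j\<close> and, by Lagrange inversion, that of \<open>A\<close> is the \<open>j\<close>-th power of the
  compositional inverse of \<open>z / \<phi>\<close>. The product of the matrices corresponds to composition;
  directly, for \<open>m = i - j > 0\<close> its entry is \<open>j / i\<close> times the coefficient of \<open>z^m\<close> in
  \<open>\<phi>^m - (z / m) (\<phi>^m)'\<close>, which vanishes.
\<close>

section \<open>Lagrange inversion in matrix form\<close>

lemma fps_nth_X_mult_deriv: "(fps_X * fps_deriv f) $ n = of_nat n * f $ n"
  by (cases n) simp_all

lemma fps_inverse_power_mult_power:
  fixes \<phi> :: "'a :: field fps"
  assumes "\<phi> $ 0 \<noteq> 0"
  shows "\<phi> ^ (m + j) * inverse \<phi> ^ j = \<phi> ^ m"
proof -
  have "\<phi> ^ (m + j) * inverse \<phi> ^ j = \<phi> ^ m * (inverse \<phi> * \<phi>) ^ j"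
    by (simp add: power_add power_mult_distrib ac_simps)
  then show ?thesis using inverse_mult_eq_1[OF assms] by simp
qed

lemma Lagrange_orthogonality:
  fixes \<phi> :: "'a :: field_char_0 fps"
  assumes \<phi>0: "\<phi> $ 0 \<noteq> 0" and j: "1 \<le> j" "j \<le> i"
  shows "(\<Sum>k=j..i. of_nat k / of_nat i * (\<phi> ^ i) $ (i - k) * (inverse \<phi> ^ j) $ (k - j))
           = (if i = j then 1 else 0)"
proof -
  define m where "m = i - j"
  have i: "i = m + j" using j by (simp add: m_def)
  define \<psi> where "\<psi> = inverse \<phi>"
  \<comment> \<open>The operator j + z d/dz multiplies the coefficient of z^l by l + j = k. So
    \<open>h\<close> absorbs the weight k and the sum becomes a coefficient of a product.\<close>
  define h where "h = of_nat j * \<psi> ^ j + fps_X * fps_deriv (\<psi> ^ j)"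
  have h_nth: "h $ l = of_nat (l + j) * (\<psi> ^ j) $ l" for l
    by (simp add: h_def fps_nth_X_mult_deriv algebra_simps flip: fps_of_nat)
  have "(\<Sum>k=j..i. of_nat k / of_nat i * (\<phi> ^ i) $ (i - k) * (\<psi> ^ j) $ (k - j))
      = (\<Sum>l=0..m. of_nat (l + j) / of_nat i * (\<phi> ^ i) $ (m - l) * (\<psi> ^ j) $ l)"
    by (rule sum.reindex_bij_witness[of _ "\<lambda>l. l + j" "\<lambda>k. k - j"]) (auto simp: i)
  also have "\<dots> = (h * \<phi> ^ i) $ m / of_nat i"
    by (simp add: fps_mult_nth h_nth sum_divide_distrib mult_ac)
  finally have lhs: "(\<Sum>k=j..i. of_nat k / of_nat i * (\<phi> ^ i) $ (i - k) * (\<psi> ^ j) $ (k - j))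
      = (h * \<phi> ^ i) $ m / of_nat i" .
  have d: "fps_deriv (\<psi> ^ j) = - of_nat j * fps_deriv \<phi> * \<psi> ^ (j + 1)"
  proof -
    have "fps_deriv \<psi> = - fps_deriv \<phi> * \<psi>\<^sup>2"
      unfolding \<psi>_def by (rule fps_inverse_deriv[OF \<phi>0])
    moreover have "\<psi> ^ (j + 1) = \<psi>\<^sup>2 * \<psi> ^ (j - 1)"
      using j by (simp flip: power_add)
    ultimately show ?thesis by (simp add: fps_deriv_power' mult_ac)
  qed
  have cancel: "\<phi> ^ i * \<psi> ^ j = \<phi> ^ m"
    unfolding i \<psi>_def by (rule fps_inverse_power_mult_power[OF \<phi>0])
  have "h * \<phi> ^ i = of_nat j * (\<phi> ^ i * \<psi> ^ j)
                   - of_nat j * (fps_X * (fps_deriv \<phi> * (\<phi> ^ i * \<psi> ^ (j + 1))))"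
    by (simp add: h_def d algebra_simps)
  also have "\<dots> = of_nat j * (\<phi> ^ m - fps_X * (fps_deriv \<phi> * (\<phi> ^ i * \<psi> ^ (j + 1))))"
    by (simp add: cancel algebra_simps)
  finally have h\<phi>: "h * \<phi> ^ i = of_nat j * (\<phi> ^ m - fps_X * (fps_deriv \<phi> * (\<phi> ^ i * \<psi> ^ (j + 1))))" .
  have "(h * \<phi> ^ i) $ m / of_nat i = (if i = j then 1 else 0)"
  proof (cases m)
    \<comment> \<open>Here i = j. The term with \<open>fps_X\<close> has no constant coefficient,
      which leaves j / i = 1.\<close>
    case 0
    then show ?thesis using h\<phi> i j by (simp flip: fps_of_nat)
  next
    case (Suc m')
    have "\<phi> ^ i * \<psi> ^ (j + 1) = \<phi> ^ m'"
      using fps_inverse_power_mult_power[OF \<phi>0, of m' "j + 1"] by (simp add: i Suc \<psi>_def)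
    \<comment> \<open>Scaling by m turns the bracket into m \<phi>^m - z (\<phi>^m)', because
      (\<phi>^m)' = m \<phi>' \<phi>^(m - 1). As z d/dz multiplies the coefficient of z^m by m, the
      two terms cancel there; characteristic zero then removes the factor m.\<close>
    then have "of_nat m * (h * \<phi> ^ i)
        = of_nat j * (of_nat m * \<phi> ^ m - fps_X * fps_deriv (\<phi> ^ m))"
      by (simp only: h\<phi> fps_deriv_power' Suc diff_Suc_1) (simp add: algebra_simps)
    then have "(of_nat m * (h * \<phi> ^ i)) $ m = 0"
      by (simp add: fps_nth_X_mult_deriv flip: fps_of_nat)
    then have "(h * \<phi> ^ i) $ m = 0"
      using Suc by (simp flip: fps_of_nat del: of_nat_Suc)
    then show ?thesis using Suc i by simp
  qed
  with lhs show ?thesis by (simp add: \<psi>_def)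
qed

section \<open>Coefficients of the transformed Jacobi polynomials\<close>

text \<open>Both sides are the coefficient of z^n in (1 + x z)^a (1 + z)^b; the right one comes from
  1 + x z = (1 + z) + (x - 1) z. The proof expands x^r in powers of x - 1, applies trinomial
  revision, swaps the sums and closes the inner one by Vandermonde.\<close>

lemma sum_gbinomial_shift:
  fixes a b x :: "'a :: field_char_0"
  shows "(\<Sum>r\<le>n. (a gchoose r) * (b gchoose (n - r)) * x ^ r)
       = (\<Sum>m\<le>n. (a gchoose m) * ((a + b - of_nat m) gchoose (n - m)) * (x - 1) ^ m)"
proof -
  have inner: "(\<Sum>r=m..n. (a - of_nat m gchoose (r - m)) * (b gchoose (n - r)))
             = (a + b - of_nat m) gchoose (n - m)" if "m \<le> n" for m
  proof -
    have "(\<Sum>r=m..n. (a - of_nat m gchoose (r - m)) * (b gchoose (n - r)))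
        = (\<Sum>s=0..n - m. (a - of_nat m gchoose s) * (b gchoose (n - m - s)))"
      using that by (intro sum.reindex_bij_witness[of _ "\<lambda>s. s + m" "\<lambda>r. r - m"]) auto
    then show ?thesis
      by (simp only: gbinomial_Vandermonde diff_add_eq)
  qed
  have "(\<Sum>r\<le>n. (a gchoose r) * (b gchoose (n - r)) * x ^ r)
      = (\<Sum>r\<le>n. \<Sum>m\<le>r. (a gchoose m) * (a - of_nat m gchoose (r - m))
           * (b gchoose (n - r)) * (x - 1) ^ m)"
  proof (rule sum.cong[OF refl])
    fix r
    have "x ^ r = (\<Sum>m\<le>r. of_nat (r choose m) * (x - 1) ^ m)"
      using binomial_ring[of "x - 1" 1 r] by simp
    then have "(a gchoose r) * (b gchoose (n - r)) * x ^ r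
        = (\<Sum>m\<le>r. ((a gchoose r) * (of_nat r gchoose m)) * (b gchoose (n - r)) * (x - 1) ^ m)"
      by (simp add: sum_distrib_left binomial_gbinomial mult_ac)
    then show "(a gchoose r) * (b gchoose (n - r)) * x ^ r
        = (\<Sum>m\<le>r. (a gchoose m) * (a - of_nat m gchoose (r - m))
             * (b gchoose (n - r)) * (x - 1) ^ m)"
      by (simp add: gbinomial_trinomial_revision)
  qed
  also have "\<dots> = (\<Sum>m\<le>n. \<Sum>r=m..n. (a gchoose m) * (a - of_nat m gchoose (r - m))
           * (b gchoose (n - r)) * (x - 1) ^ m)"
    by (simp add: sum.Sigma, rule sum.reindex_bij_witness[of _ prod.swap prod.swap]) auto
  also have "\<dots> = (\<Sum>m\<le>n. (a gchoose m)
           * (\<Sum>r=m..n. (a - of_nat m gchoose (r - m)) * (b gchoose (n - r))) * (x - 1) ^ m)"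
    by (simp add: sum_distrib_left sum_distrib_right mult_ac)
  finally show ?thesis by (simp add: inner)
qed

text \<open>Reversing the index, i to n - i, makes the product a falling factorial. This converts
  both products in \<open>jacobi_poly\<close>.\<close>

lemma gbinomial_prod_shift:
  fixes a :: "'a :: field_char_0"
  assumes "k \<le> n"
  shows "(\<Prod>i=k+1..n. a + of_nat i) = fact (n - k) * (of_nat n + a gchoose (n - k))"
proof -
  have "(\<Prod>i=k+1..n. a + of_nat i) = (\<Prod>i=0..<n - k. of_nat n + a - of_nat i)"
    by (rule prod.reindex_bij_witness[of _ "\<lambda>i. n - i" "\<lambda>i. n - i"])
      (use assms in \<open>auto simp: of_nat_diff\<close>)
  then show ?thesis by (simp add: gbinomial_mult_fact)
qed

section \<open>Substitution in the fraction field\<close>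

lemma map_poly_to_fract_add:
  "map_poly (\<lambda>c. to_fract [:c:]) (p + q)
     = map_poly (\<lambda>c. to_fract [:c:]) p + map_poly (\<lambda>c. to_fract [:c:]) q"
  for p q :: "'a :: idom poly"
  by (rule poly_eqI) (simp add: coeff_map_poly flip: to_fract_add)

lemma map_poly_to_fract_sum:
  fixes f :: "'b \<Rightarrow> 'a :: idom poly"
  shows "map_poly (\<lambda>c. to_fract [:c:]) (sum f S) = (\<Sum>i\<in>S. map_poly (\<lambda>c. to_fract [:c:]) (f i))"
  by (induction S rule: infinite_finite_induct) (simp_all add: map_poly_to_fract_add)

lemma smult_sum_right: "smult c (sum f S) = (\<Sum>i\<in>S. smult c (f i))"
  by (induction S rule: infinite_finite_induct) (simp_all add: smult_add_right)

lemma map_poly_to_fract_smult: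
  "map_poly (\<lambda>c. to_fract [:c:]) (smult a p) = smult (to_fract [:a:]) (map_poly (\<lambda>c. to_fract [:c:]) p)"
  for p :: "'a :: idom poly"
  by (rule poly_eqI) (simp add: coeff_map_poly flip: to_fract_mult)

lemma map_poly_to_fract_mult:
  "map_poly (\<lambda>c. to_fract [:c:]) (p * q)
     = map_poly (\<lambda>c. to_fract [:c:]) p * map_poly (\<lambda>c. to_fract [:c:]) q"
  for p q :: "'a :: idom poly"
  by (induction p)
    (simp_all add: map_poly_pCons map_poly_to_fract_add map_poly_to_fract_smult)

lemma map_poly_to_fract_power:
  "map_poly (\<lambda>c. to_fract [:c:]) (p ^ n) = map_poly (\<lambda>c. to_fract [:c:]) p ^ n"
  for p :: "'a :: idom poly"
  by (induction n) (simp_all add: map_poly_to_fract_mult map_poly_1' flip: one_pCons)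

lemma to_fract_power: "to_fract (a ^ n) = to_fract a ^ n"
  by (induction n) simp_all

lemma to_fract_sum: "to_fract (sum f S) = (\<Sum>i\<in>S. to_fract (f i))"
  by (induction S rule: infinite_finite_induct) simp_all

text \<open>Since \<open>N - D\<close> is 2, the substitution sends (x - 1) / 2 to
  \<open>1 / D\<close>, and \<open>D ^ n\<close> clears the denominators.\<close>

lemma cayley_transform_sum:
  "cayley_transform n (\<Sum>k\<le>n. smult (c k) ([:- (1 / 2), 1 / 2:] ^ k))
     = to_fract (\<Sum>k\<le>n. smult (c k) ([:- 1, 1:] ^ (n - k)))"
proof -
  define D N :: "rat poly fract" where "D = to_fract [:- 1, 1:]" and "N = to_fract [:1, 1:]"
  have D0: "D \<noteq> 0" by (simp add: D_def)
  have "N - D = to_fract [:2:]"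
    unfolding D_def N_def by (simp flip: to_fract_diff)
  then have ND: "to_fract [:1 / 2:] * (N - D) = 1"
    by (simp flip: to_fract_mult one_pCons)
  have "to_fract [:- (1 / 2):] + N / D * to_fract [:1 / 2:] = to_fract [:1 / 2:] * (N - D) / D"
    using D0 to_fract_uminus[of "[:1 / 2 :: rat:]"] by (simp add: field_simps)
  then have half: "poly (map_poly (\<lambda>c. to_fract [:c:]) [:- (1 / 2), 1 / 2:]) (N / D) = 1 / D"
    by (simp add: map_poly_pCons ND)
  have "cayley_transform n (\<Sum>k\<le>n. smult (c k) ([:- (1 / 2), 1 / 2:] ^ k))
      = D ^ n * (\<Sum>k\<le>n. to_fract [:c k:] * (1 / D) ^ k)"
    unfolding cayley_transform_def Fract_conv_to_fract D_def[symmetric] N_def[symmetric]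
    by (simp only: map_poly_to_fract_sum map_poly_to_fract_smult map_poly_to_fract_power
        poly_sum poly_smult poly_power half)
  also have "\<dots> = (\<Sum>k\<le>n. to_fract [:c k:] * D ^ (n - k))"
    unfolding sum_distrib_left
    by (intro sum.cong refl) (use D0 in \<open>simp add: power_diff power_divide\<close>)
  also have "\<dots> = to_fract (\<Sum>k\<le>n. [:c k:] * [:- 1, 1:] ^ (n - k))"
    by (simp only: to_fract_sum to_fract_mult to_fract_power D_def)
  finally show ?thesis by simp
qed

text \<open>The substitution leaves an expansion in powers of x - 1 with generalised binomial
  coefficients, which \<open>sum_gbinomial_shift\<close> re-expands in powers of x.\<close>

lemma jacobi_p_eq:
  "jacobi_p n \<alpha> \<beta>
     = (\<Sum>r\<le>n. monom ((of_nat n + \<alpha> gchoose r) * (of_nat n + \<beta> gchoose (n - r))) r)"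
    (is "_ = ?q")
proof -
  define a b where "a = of_nat n + \<alpha>" and "b = of_nat n + \<beta>"
  define c where "c k = (a gchoose (n - k)) * ((a + b - of_nat (n - k)) gchoose k)" for k
  have coef: "1 / fact n * (of_nat (n choose k) * (\<Prod>i=1..k. of_nat n + \<alpha> + \<beta> + of_nat i)
                * (\<Prod>i=k+1..n. \<alpha> + of_nat i)) = c k" if "k \<le> n" for k
  proof -
    have "(\<Prod>i=1..k. of_nat n + \<alpha> + \<beta> + of_nat i)
        = fact k * ((a + b - of_nat (n - k)) gchoose k)"
      \<comment> \<open>The upper entries agree: a + b - (n - k) = n + \<alpha> + \<beta> +
        k.\<close>
      using gbinomial_prod_shift[of 0 k "of_nat n + \<alpha> + \<beta>"] that
      by (simp add: a_def b_def of_nat_diff algebra_simps)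
    moreover have "(\<Prod>i=k+1..n. \<alpha> + of_nat i) = fact (n - k) * (a gchoose (n - k))"
      unfolding a_def by (rule gbinomial_prod_shift[OF that])
    ultimately show ?thesis
      using that by (simp only: c_def binomial_fact) (simp add: field_simps)
  qed
  have "jacobi_poly n \<alpha> \<beta> = (\<Sum>k\<le>n. smult (c k) ([:- (1 / 2), 1 / 2:] ^ k))"
    unfolding jacobi_poly_def smult_sum_right smult_smult
    by (intro sum.cong refl) (simp only: coef atMost_iff)
  then have "to_fract (jacobi_p n \<alpha> \<beta>) = to_fract (\<Sum>k\<le>n. smult (c k) ([:- 1, 1:] ^ (n - k)))"
    by (simp only: to_fract_jacobi_p cayley_transform_sum)
  then have p: "jacobi_p n \<alpha> \<beta> = (\<Sum>k\<le>n. smult (c k) ([:- 1, 1:] ^ (n - k)))"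
    by (simp only: to_fract_eq_iff)
  have "poly (jacobi_p n \<alpha> \<beta>) x = poly ?q x" for x
  proof -
    have "poly (jacobi_p n \<alpha> \<beta>) x = (\<Sum>k\<le>n. c k * (x - 1) ^ (n - k))"
      by (simp add: p poly_sum)
    also have "\<dots> = (\<Sum>m\<le>n. (a gchoose m) * ((a + b - of_nat m) gchoose (n - m)) * (x - 1) ^ m)"
      by (rule sum.reindex_bij_witness[of _ "\<lambda>m. n - m" "\<lambda>k. n - k"]) (auto simp: c_def)
    also have "\<dots> = poly ?q x"
      by (simp only: sum_gbinomial_shift[symmetric] poly_sum poly_monom a_def b_def)
    finally show ?thesis .
  qed
  then show ?thesis by (simp add: fun_eq_iff flip: poly_eq_poly_eq_iff)
qed

section \<open>Passage to k and generating functions\<close>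

lemma of_rat_gbinomial: "of_rat (a gchoose k) = (of_rat a gchoose k :: 'a :: field_char_0)"
proof -
  have "of_rat (fact k) = (fact k :: 'a)"
    by (metis of_nat_fact of_rat_of_nat_eq)
  then show ?thesis
    by (simp add: gbinomial_prod_rev of_rat_divide of_rat_prod of_rat_diff)
qed

text \<open>\<open>fps_binomial a oo (fps_const x * fps_X)\<close> is \<open>(1 + x z)^a\<close>.\<close>

lemma poly_map_poly_of_rat_jacobi_p:
  fixes x :: "'k :: field_char_0"
  shows "poly (map_poly of_rat (jacobi_p n \<alpha> \<beta>)) x
       = ((fps_binomial (of_nat n + of_rat \<alpha>) oo (fps_const x * fps_X))
            * fps_binomial (of_nat n + of_rat \<beta>)) $ n"
proof -
  have "map_poly of_rat (jacobi_p n \<alpha> \<beta>)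
      = (\<Sum>r\<le>n. monom ((of_nat n + of_rat \<alpha> gchoose r)
           * (of_nat n + of_rat \<beta> gchoose (n - r)) :: 'k) r)"
    by (rule poly_eqI)
      (simp add: jacobi_p_eq coeff_map_poly coeff_sum of_rat_sum of_rat_mult of_rat_gbinomial
        of_rat_add coeff_monom if_distrib cong: if_cong)
  then show ?thesis
    by (simp add: fps_mult_nth poly_sum poly_monom atLeast0AtMost)
      (simp add: mult_ac)
qed

theorem mainTheorem5:
  fixes A B :: "nat \<Rightarrow> nat \<Rightarrow> 'k :: field_char_0 poly"
  assumes "lower_triangular A" and "lower_triangular B"
    and "\<And>i j. 1 \<le> j \<Longrightarrow> j \<le> i \<Longrightarrow>
           A i j = smult (of_nat j / of_nat i)
                     (map_poly of_rat (jacobi_p (i - j) (of_nat j) (of_nat j)))"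
    and "\<And>i j. 1 \<le> j \<Longrightarrow> j \<le> i \<Longrightarrow>
           B i j = map_poly of_rat (jacobi_p (i - j) (- of_nat i) (- of_nat i))"
  shows "\<forall>i\<ge>1. \<forall>j\<ge>1. inf_mat_mult A B i j = (if i = j then 1 else 0)"
proof (intro allI impI)
  fix i j :: nat
  assume i: "1 \<le> i" and j: "1 \<le> j"
  have prod: "inf_mat_mult A B i j = (\<Sum>k=j..i. A i k * B k j)"
    by (rule inf_mat_mult_lower_triangular(2)[OF assms(1,2) i j])
  show "inf_mat_mult A B i j = (if i = j then 1 else 0)"
  proof (cases "j \<le> i")
    case False
    then show ?thesis by (simp add: prod)
  next
    case True
    \<comment> \<open>Fixing a value x in the infinite field k makes \<phi> a power series over a
      field, as Lagrange inversion requires.\<close>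
    have "poly (\<Sum>k=j..i. A i k * B k j) x = poly (if i = j then 1 else 0) x" for x
    proof -
      define X :: "'k fps" where "X = fps_const x * fps_X"
      define \<phi> where "\<phi> = ((1 + fps_X) oo X) * (1 + fps_X)"
      have X0: "X $ 0 = 0" by (simp add: X_def)
      have pow: "\<phi> ^ m = (fps_binomial (of_nat m) oo X) * fps_binomial (of_nat m)" for m
        unfolding \<phi>_def
        by (simp add: fps_binomial_of_nat fps_compose_power[OF X0] power_mult_distrib)
      have ipow: "inverse \<phi> ^ m
          = (fps_binomial (- of_nat m) oo X) * fps_binomial (- of_nat m)" for m
        unfolding fps_inverse_power[symmetric] pow
        by (simp add: fps_inverse_mult fps_binomial_minus_of_nat fps_binomial_of_nat
            fps_inverse_compose[OF X0])
      have A: "poly (A i k) x = of_nat k / of_nat i * (\<phi> ^ i) $ (i - k)"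
        if "k \<in> {j..i}" for k
      proof -
        have k: "1 \<le> k" "k \<le> i" using that j by auto
        \<comment> \<open>The exponent n + \<alpha> is i for every k, so one series \<phi>^i serves
          the whole row.\<close>
        have e: "of_nat (i - k) + of_rat (of_nat k) = (of_nat i :: 'k)"
          using k by (simp add: of_nat_diff)
        show ?thesis
          by (simp only: assms(3)[OF k] poly_smult poly_map_poly_of_rat_jacobi_p e pow X_def mult.assoc)
      qed
      have B: "poly (B k j) x = (inverse \<phi> ^ j) $ (k - j)" if "k \<in> {j..i}" for k
      proof -
        have k: "j \<le> k" using that by simp
        \<comment> \<open>Here n + \<alpha> is -j for every k, so \<phi>^(-j) serves the whole
          column.\<close>
        have e: "of_nat (k - j) + of_rat (- of_nat k) = (- of_nat j :: 'k)"
          using k by (simp add: of_nat_diff of_rat_minus)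
        show ?thesis
          by (simp only: assms(4)[OF j k] poly_map_poly_of_rat_jacobi_p e ipow X_def)
      qed
      have "poly (\<Sum>k=j..i. A i k * B k j) x
          = (\<Sum>k=j..i. of_nat k / of_nat i * (\<phi> ^ i) $ (i - k) * (inverse \<phi> ^ j) $ (k - j))"
        by (simp only: poly_sum poly_mult A B cong: sum.cong)
      also have "\<dots> = (if i = j then 1 else 0)"
        by (rule Lagrange_orthogonality[OF _ j True]) (simp add: \<phi>_def)
      finally show ?thesis by simp
    qed
    then show ?thesis unfolding prod by (simp add: fun_eq_iff flip: poly_eq_poly_eq_iff)
  qed
qed

end
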